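(* Let $k$ be an infinite field and $I$ a countably infinite set. Then there exists a $k$-subspace $W\subseteq k^I$ of dimension $2^{\aleph_0}$ (continuum dimensionality) such that no nonzero member of $W$ has infinitely many zeroes (i.e., every nonzero $(w_i)_{i\in I}\in W$ has $w_i=0$ for only finitely many $i\in I$). Hence any $k$-linear map $g$ from $k^I$ to a $k$-vector space $V$ of less than continuum dimension (i.e., $\dim_k(V)<2^{\aleph_0}$) has in its kernel an element $u$ of cofinite support.
   Context: For $u=(u_i)_{i\in I}\in k^I$, $\mathrm{supp}(u)=\{i\in I\mid u_i\neq 0\}$; $u$ has cofinite support if $I-\mathrm{supp}(u)$ is finite. *)

theory Defs
  imports Complex_Main "HOL-Library.Function_Algebras" "HOL-Library.Countable_Set"
begin

unbundle cardinal_syntax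

definition fun_scale :: "'k::field \<Rightarrow> ('i \<Rightarrow> 'k) \<Rightarrow> 'i \<Rightarrow> 'k" where
  "fun_scale c u = (\<lambda>i. c * u i)"

lemma vector_space_fun_scale: "vector_space fun_scale"
  by unfold_locales (auto simp: fun_scale_def fun_eq_iff algebra_simps)

definition supp :: "('i \<Rightarrow> 'k::zero) \<Rightarrow> 'i set" where
  "supp u = {i. u i \<noteq> 0}"

definition cofinite_support :: "('i \<Rightarrow> 'k::zero) \<Rightarrow> bool" where
  "cofinite_support u \<longleftrightarrow> finite (UNIV - supp u)"

(* The dimension as a cardinal; the library's dim is a natural number, hence 0 for every
   infinite-dimensional space. Intended for subspaces V. *)
definition card_dim :: "('k::field \<Rightarrow> 'v::ab_group_add \<Rightarrow> 'v) \<Rightarrow> 'v set \<Rightarrow> 'v rel" where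
  "card_dim s V = |SOME B. B \<subseteq> V \<and> \<not> module.dependent s B \<and> module.span s B = V|"

lemma card_dim_basis:
  assumes "vector_space s" and "module.subspace s V"
  shows "\<exists>B. B \<subseteq> V \<and> \<not> module.dependent s B \<and> module.span s B = V \<and> card_dim s V = |B|"
proof -
  interpret vector_space s by fact
  obtain B where "B \<subseteq> V" "independent B" "V \<subseteq> span B"
    using maximal_independent_subset[of V] by blast
  then have "B \<subseteq> V \<and> independent B \<and> span B = V"
    using span_minimal[OF _ assms(2)] by blast
  then show ?thesis
    unfolding card_dim_def by (metis (mono_tags, lifting) someI_ex)
qed

abbreviation continuum :: "(nat \<Rightarrow> bool) rel" where
  "continuum \<equiv> ctwo ^c natLeq"

end

(* Fix pairwise distinct exponent sequences e_f, one for each binary branch f, where e_f(n) encodes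
   the first n digits of f, and put w_f(n) = c(n)^(e_f(n)). The scalars c(n) are chosen
   recursively: whenever the coefficient vectors of combinations of m + 1 branches that vanish at
   m given earlier times form a line, these combinations, taken at time n, are the multiples of one
   nonzero polynomial in c(n). Up to scalars, only finitely many such polynomials arise at each n,
   so c(n) can avoid all their roots. Hence a nontrivial combination of m branches
   vanishes at fewer than m times after the branches have separated, and the span of the w_f is
   the required space W. A linear map without kernel elements of cofinite support is injective
   on W. *)
theory Submission
  imports Defs "HOL-Computational_Algebra.Polynomial"
begin

section \<open>Finite prefixes of binary branches\<close>

text \<open>The earliest digit gets the lowest weight, so that cutting a prefix down to length
  \<open>m\<close> is reduction modulo \<open>2 ^ m\<close>.\<close>

definition prefix_code :: "(nat \<Rightarrow> bool) \<Rightarrow> nat \<Rightarrow> nat" where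
  "prefix_code f n = (\<Sum>i<n. of_bool (f i) * 2 ^ i)"

lemma prefix_code_Suc: "prefix_code f (Suc n) = prefix_code f n + of_bool (f n) * 2 ^ n"
  by (simp add: prefix_code_def)

lemma prefix_code_less: "prefix_code f n < 2 ^ n"
  by (induction n) (auto simp: prefix_code_Suc prefix_code_def[of f 0])

lemma prefix_code_mod: "m \<le> n \<Longrightarrow> prefix_code f n mod 2 ^ m = prefix_code f m"
proof (induction n rule: dec_induct)
  case base
  show ?case by (simp add: prefix_code_less)
next
  case (step n)
  have "(2::nat) ^ m dvd 2 ^ n" using step by (simp add: le_imp_power_dvd)
  then have "(of_bool (f n) * 2 ^ n :: nat) mod 2 ^ m = 0" by simp
  then show ?case using step.IH by (metis add.right_neutral mod_add_right_eq prefix_code_Suc)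
qed

lemma prefix_code_eq_imp:
  assumes "prefix_code f n = prefix_code g n" "i < n"
  shows "f i = g i"
proof -
  have "prefix_code f (Suc i) = prefix_code g (Suc i)" "prefix_code f i = prefix_code g i"
    using assms prefix_code_mod[of "Suc i" n] prefix_code_mod[of i n]
    by (metis Suc_leI, metis less_imp_le)
  then show ?thesis by (simp add: prefix_code_Suc of_bool_def split: if_splits)
qed

lemma eventually_inj_on_prefix_code:
  assumes "finite F"
  obtains N where "\<And>n. n \<ge> N \<Longrightarrow> inj_on (\<lambda>f. prefix_code f n) F"
proof -
  have "\<exists>i. f i \<noteq> g i" if "f \<noteq> g" for f g :: "nat \<Rightarrow> bool" using that by auto
  then obtain d where d: "\<And>f g :: nat \<Rightarrow> bool. f \<noteq> g \<Longrightarrow> f (d f g) \<noteq> g (d f g)" by metis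
  let ?D = "(\<lambda>(f, g). d f g) ` (F \<times> F)"
  have fin: "finite ?D" using assms by simp
  show ?thesis
  \<comment> \<open>Beyond every chosen position of difference the prefixes are distinct. For empty
    \<open>F\<close> the unspecified \<open>Max ?D\<close> does no harm.\<close>
  proof (rule that[of "Suc (Max ?D)"])
    fix n assume n: "n \<ge> Suc (Max ?D)"
    show "inj_on (\<lambda>f. prefix_code f n) F"
    proof (rule inj_onI)
      fix f g assume fg: "f \<in> F" "g \<in> F" "prefix_code f n = prefix_code g n"
      have "d f g \<le> Max ?D" using fg by (intro Max_ge fin) auto
      then have "d f g < n" using n by simp
      then show "f = g" using d prefix_code_eq_imp[OF fg(3)] by blast
    qed
  qed
qed

section \<open>The choice of the scalars\<close>

text \<open>Here \<open>e\<close> encodes a prefix of length at least \<open>s\<close>, and \<open>e mod 2 ^ s\<close> its prefix of length \<open>s\<close>.\<close>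

definition annihilates :: "(nat \<Rightarrow> 'k::field) \<Rightarrow> nat set \<Rightarrow> nat set \<Rightarrow> (nat \<Rightarrow> 'k) \<Rightarrow> bool" where
  "annihilates c S E a \<longleftrightarrow> (\<forall>s\<in>S. (\<Sum>e\<in>E. a e * c s ^ (e mod 2 ^ s)) = 0)"

text \<open>The solution space of the linear system, with vectors read on \<open>E\<close> only, is
  a line with basis vector \<open>a\<close>.\<close>

definition spans_annihilators :: "(nat \<Rightarrow> 'k::field) \<Rightarrow> nat set \<Rightarrow> nat set \<Rightarrow> (nat \<Rightarrow> 'k) \<Rightarrow> bool" where
  "spans_annihilators c S E a \<longleftrightarrow> annihilates c S E a \<and> (\<exists>e\<in>E. a e \<noteq> 0) \<and>
     (\<forall>b. annihilates c S E b \<longrightarrow> (\<exists>t. \<forall>e\<in>E. b e = t * a e))"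

text \<open>Since \<open>S\<close> lies below \<open>n\<close>, only earlier values of
  \<open>c\<close> enter, which makes a recursive choice possible. The bound on \<open>E\<close>
  admits all codes of length \<open>n\<close>.\<close>

definition bad_scalars :: "(nat \<Rightarrow> 'k::field) \<Rightarrow> nat \<Rightarrow> 'k set" where
  "bad_scalars c n = {z. \<exists>S\<subseteq>{..<n}. \<exists>E\<subseteq>{..<2 ^ n}. \<exists>a.
     spans_annihilators c S E a \<and> (\<Sum>e\<in>E. a e * z ^ e) = 0}"

lemma finite_zeros_sum_powers:
  fixes a :: "nat \<Rightarrow> 'k::field"
  assumes "finite E" "e0 \<in> E" "a e0 \<noteq> 0"
  shows "finite {z. (\<Sum>e\<in>E. a e * z ^ e) = 0}"
proof -
  let ?p = "\<Sum>e\<in>E. monom (a e) e"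
  have "coeff ?p e0 = a e0" using assms by (simp add: coeff_sum)
  then have "?p \<noteq> 0" using assms by (metis coeff_0)
  then have "finite {z. poly ?p z = 0}" by (rule poly_roots_finite)
  then show ?thesis by (simp add: poly_sum poly_monom)
qed

text \<open>There are finitely many pairs \<open>S\<close>, \<open>E\<close>. For each pair all
  spanning vectors are proportional, so the roots of one nonzero polynomial cover every choice of
  \<open>a\<close>.\<close>

lemma finite_bad_scalars: "finite (bad_scalars c n)"
proof -
  define R where "R S E = {z. \<exists>a. spans_annihilators c S E a \<and> (\<Sum>e\<in>E. a e * z ^ e) = 0}" for S E
  have "finite (R S E)" if "finite E" for S E
  proof (cases "\<exists>a. spans_annihilators c S E a")
    case True
    then obtain a where a: "spans_annihilators c S E a" ..
    have "R S E \<subseteq> {z. (\<Sum>e\<in>E. a e * z ^ e) = 0}"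
    proof
      fix z assume "z \<in> R S E"
      then obtain b where b: "spans_annihilators c S E b" "(\<Sum>e\<in>E. b e * z ^ e) = 0"
        by (auto simp: R_def)
      then obtain t where t: "\<forall>e\<in>E. a e = t * b e"
        using a unfolding spans_annihilators_def by blast
      have "(\<Sum>e\<in>E. a e * z ^ e) = t * (\<Sum>e\<in>E. b e * z ^ e)"
        using t by (simp add: sum_distrib_left mult.assoc)
      then show "z \<in> {z. (\<Sum>e\<in>E. a e * z ^ e) = 0}" using b by simp
    qed
    moreover have "finite {z. (\<Sum>e\<in>E. a e * z ^ e) = 0}"
      using a that by (auto simp: spans_annihilators_def intro: finite_zeros_sum_powers)
    ultimately show ?thesis by (rule finite_subset)
  qed (simp add: R_def)
  then have "finite (\<Union>S\<in>Pow {..<n}. \<Union>E\<in>Pow {..<2 ^ n}. R S E)"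
    by (meson PowD finite_Pow_iff finite_UN_I finite_lessThan finite_subset)
  moreover have "bad_scalars c n = (\<Union>S\<in>Pow {..<n}. \<Union>E\<in>Pow {..<2 ^ n}. R S E)"
    unfolding bad_scalars_def R_def by blast
  ultimately show ?thesis by simp
qed

lemma bad_scalars_cong:
  assumes "\<And>m. m < n \<Longrightarrow> c m = d m"
  shows "bad_scalars c n = bad_scalars d n"
proof -
  have "annihilates c S E = annihilates d S E" if "S \<subseteq> {..<n}" for S E
    using assms that by (auto simp: annihilates_def fun_eq_iff subset_iff)
  then have "spans_annihilators c S E = spans_annihilators d S E" if "S \<subseteq> {..<n}" for S E
    using that by (simp add: spans_annihilators_def fun_eq_iff)
  then show ?thesis by (simp add: bad_scalars_def cong: conj_cong)
qed

lemma ex_avoiding_bad_scalars: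
  assumes "infinite (UNIV :: 'k::field set)"
  shows "\<exists>c :: nat \<Rightarrow> 'k. \<forall>n. c n \<notin> bad_scalars c n"
proof (rule dependent_wellorder_choice)
  fix r :: 'k and c d :: "nat \<Rightarrow> 'k" and n :: nat
  assume "\<And>m. m < n \<Longrightarrow> c m = d m"
  then show "(r \<notin> bad_scalars c n) = (r \<notin> bad_scalars d n)" by (simp cong: bad_scalars_cong)
next
  fix n :: nat and c :: "nat \<Rightarrow> 'k"
  show "\<exists>r. r \<notin> bad_scalars c n" using ex_new_if_finite[OF assms finite_bad_scalars] .
qed

text \<open>Induction on the times, adding the largest time \<open>n\<close> last. If
  \<open>a f\<close> is nonzero, the induction hypothesis for the branches other than
  \<open>f\<close> shows that the annihilators at the earlier times form the line spanned by
  \<open>a\<close>. Vanishing at \<open>n\<close> would then make \<open>c n\<close> a bad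
  scalar.\<close>

lemma vanishing_combination_trivial:
  fixes c :: "nat \<Rightarrow> 'k::field" and a :: "(nat \<Rightarrow> bool) \<Rightarrow> 'k"
  assumes c: "\<And>n. c n \<notin> bad_scalars c n"
    and "finite S" "finite F" "card F = card S"
    and "\<And>s. s \<in> S \<Longrightarrow> inj_on (\<lambda>f. prefix_code f s) F"
    and "\<And>s. s \<in> S \<Longrightarrow> (\<Sum>f\<in>F. a f * c s ^ prefix_code f s) = 0"
    and "f \<in> F"
  shows "a f = 0"
  using assms(2-)
proof (induction S arbitrary: F a f rule: finite_linorder_max_induct)
  case empty
  then show ?case by simp
next
  case (insert n S)
  show ?case
  proof (rule ccontr)
    assume nz: "a f \<noteq> 0"
    let ?q = "\<lambda>f. prefix_code f n"
    define E where "E = ?q ` F"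
    have inj: "inj_on ?q F" using insert.prems by simp
    \<comment> \<open>Coefficients move from branches to their codes at time \<open>n\<close>, which
      are distinct on \<open>F\<close>; codes at earlier times are recovered by reduction.\<close>
    define a' where "a' e = a (inv_into F ?q e)" for e
    have a': "a' (?q g) = a g" if "g \<in> F" for g using inv_into_f_f[OF inj that] by (simp add: a'_def)
    have sum_E: "(\<Sum>e\<in>E. h e * c s ^ (e mod 2 ^ s)) = (\<Sum>g\<in>F. h (?q g) * c s ^ prefix_code g s)"
      if "s \<le> n" for h s
      unfolding E_def using that by (simp add: sum.reindex[OF inj] prefix_code_mod)
    have less: "s < n" if "s \<in> S" for s using insert.hyps that by blast
    have ann: "annihilates c S E a'"
      unfolding annihilates_def using insert.prems less by (simp add: sum_E less_imp_le a')
    have "\<exists>t. \<forall>e\<in>E. b e = t * a' e" if b: "annihilates c S E b" for b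
    proof -
      \<comment> \<open>This multiple of \<open>a\<close> cancels the coefficient of
        \<open>b\<close> at \<open>f\<close>, leaving one branch fewer, as many as there are times
        in \<open>S\<close>.\<close>
      define t where "t = b (?q f) / a f"
      define d where "d g = b (?q g) - t * a g" for g
      have df: "d f = 0" using nz by (simp add: d_def t_def)
      have card: "card (F - {f}) = card S"
        using insert.prems insert.hyps by (auto simp: card_Diff_singleton)
      have zero: "(\<Sum>g\<in>F - {f}. d g * c s ^ prefix_code g s) = 0" if s: "s \<in> S" for s
      proof -
        have "(\<Sum>g\<in>F - {f}. d g * c s ^ prefix_code g s) = (\<Sum>g\<in>F. d g * c s ^ prefix_code g s)"
          using df insert.prems by (simp add: sum.remove[of F f])
        also have "\<dots> = (\<Sum>g\<in>F. b (?q g) * c s ^ prefix_code g s)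
            - t * (\<Sum>g\<in>F. a g * c s ^ prefix_code g s)"
          by (simp add: d_def left_diff_distrib sum_subtractf sum_distrib_left mult.assoc)
        also have "\<dots> = 0"
          using b s less[OF s] insert.prems by (simp add: annihilates_def flip: sum_E)
        finally show ?thesis .
      qed
      have "d g = 0" if "g \<in> F - {f}" for g
      proof (rule insert.IH[where F = "F - {f}" and a = d and f = g])
        show "inj_on (\<lambda>f. prefix_code f s) (F - {f})" if "s \<in> S" for s
          using insert.prems that by (meson Diff_subset inj_on_subset insertCI)
      qed (use card zero that insert.prems in auto)
      then have "\<forall>g\<in>F. b (?q g) = t * a' (?q g)" using df by (force simp: a' d_def)
      then show ?thesis unfolding E_def by blast
    qed
    then have "spans_annihilators c S E a'"
      unfolding spans_annihilators_def using ann nz a' insert.prems by (auto simp: E_def)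
    moreover have "(\<Sum>e\<in>E. a' e * c n ^ e) = 0"
      unfolding E_def using insert.prems by (simp add: sum.reindex[OF inj] a')
    moreover have "S \<subseteq> {..<n}" "E \<subseteq> {..<2 ^ n}"
      using less by (auto simp: E_def prefix_code_less)
    ultimately have "c n \<in> bad_scalars c n" unfolding bad_scalars_def by blast
    then show False using c by blast
  qed
qed

text \<open>Infinitely many zeros would include \<open>card F\<close> of them after the branches in
  \<open>F\<close> have separated.\<close>

lemma finite_zeros_combination:
  fixes c :: "nat \<Rightarrow> 'k::field"
  assumes c: "\<And>n. c n \<notin> bad_scalars c n" and F: "finite F" "f \<in> F" "a f \<noteq> 0"
  shows "finite {n. (\<Sum>f\<in>F. a f * c n ^ prefix_code f n) = 0}" (is "finite ?Z")
proof (rule ccontr)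
  assume inf: "infinite ?Z"
  obtain N where N: "\<And>n. n \<ge> N \<Longrightarrow> inj_on (\<lambda>f. prefix_code f n) F"
    using eventually_inj_on_prefix_code[OF F(1)] by blast
  have "infinite (?Z - {..<N})" using inf by simp
  then obtain S where S: "S \<subseteq> ?Z - {..<N}" "finite S" "card S = card F"
    by (meson infinite_arbitrarily_large)
  have "a f = 0"
  proof (rule vanishing_combination_trivial[OF c S(2) F(1)])
    fix s assume "s \<in> S"
    then have "s \<in> ?Z - {..<N}" using S(1) by blast
    then show "inj_on (\<lambda>f. prefix_code f s) F" "(\<Sum>f\<in>F. a f * c s ^ prefix_code f s) = 0"
      using N[of s] by auto
  qed (use S F in auto)
  then show False using F by simp
qed

section \<open>Dimension\<close>

text \<open>The cardinal power unfolds to the cardinality of the full function type, which is the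
  type of branches.\<close>

lemma continuum_eq: "continuum = |UNIV :: (nat \<Rightarrow> bool) set|"
  by (simp add: cexp_def ctwo_def Field_natLeq Field_card_of Func_def)

text \<open>Bases of the same span are in bijection, so the basis picked by \<open>SOME\<close> in
  \<open>card_dim\<close> does not affect the cardinality.\<close>

lemma card_dim_span:
  assumes "vector_space s" "\<not> module.dependent s B"
  shows "card_dim s (module.span s B) =o |B|"
proof -
  interpret vector_space s by fact
  obtain C where C: "independent C" "span C = span B" "card_dim s (span B) = |C|"
    using card_dim_basis[OF assms(1) subspace_span, of B] by blast
  then show ?thesis
    using bij_if_span_eq_span_bases[of C B] assms(2) card_of_ordIsoI by metis
qed

lemma card_independent_le_card_dim:
  assumes "vector_space s" "\<not> module.dependent s B"
  shows "|B| \<le>o card_dim s UNIV"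
proof -
  interpret vector_space s by fact
  have C: "B \<subseteq> extend_basis B" "independent (extend_basis B)" "span (extend_basis B) = UNIV"
    using assms(2) by (simp_all add: extend_basis_superset independent_extend_basis)
  have "|B| \<le>o |extend_basis B|" using C(1) by (rule card_of_mono1)
  also have "|extend_basis B| =o card_dim s UNIV"
    using card_dim_span[OF assms(1) C(2)] C(3) by (simp add: ordIso_symmetric)
  finally show ?thesis .
qed

lemma inj_on_subspace_if_cofinite_support_notin_kernel:
  assumes g: "Vector_Spaces.linear fun_scale scaleV g"
    and W: "module.subspace fun_scale W" "\<And>w. w \<in> W \<Longrightarrow> w \<noteq> 0 \<Longrightarrow> finite {i. w i = 0}"
    and ker: "\<And>u. cofinite_support u \<Longrightarrow> g u \<noteq> 0"
  shows "inj_on g W"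
proof -
  interpret Vector_Spaces.linear fun_scale scaleV g by fact
  have "w = 0" if "w \<in> W" "g w = 0" for w
  proof (rule ccontr)
    assume "w \<noteq> 0"
    then have "cofinite_support w"
      using W(2) that by (simp add: cofinite_support_def supp_def Collect_neg_eq[symmetric] Diff_eq)
    then show False using ker that by blast
  qed
  then show ?thesis using inj_on_iff_eq_0[OF W(1)] by blast
qed

section \<open>The span of the branch sequences and linear maps on it\<close>

theorem lemma6:
  assumes "infinite (UNIV :: 'k::field set)"
    and "countable (UNIV :: 'i set)" and "infinite (UNIV :: 'i set)"
  shows "(\<exists>W :: ('i \<Rightarrow> 'k) set. module.subspace fun_scale W \<and>
            card_dim fun_scale W =o continuum \<and>
            (\<forall>w\<in>W. w \<noteq> 0 \<longrightarrow> finite {i. w i = 0})) \<and>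
         (\<forall>(scaleV :: 'k \<Rightarrow> 'v \<Rightarrow> 'v::ab_group_add) (g :: ('i \<Rightarrow> 'k) \<Rightarrow> 'v).
            vector_space scaleV \<longrightarrow> card_dim scaleV UNIV <o continuum \<longrightarrow>
            Vector_Spaces.linear fun_scale scaleV g \<longrightarrow>
            (\<exists>u. g u = 0 \<and> cofinite_support u))"
proof -
  interpret vs: vector_space "fun_scale :: 'k \<Rightarrow> ('i \<Rightarrow> 'k) \<Rightarrow> _" by (rule vector_space_fun_scale)
  obtain c :: "nat \<Rightarrow> 'k" where c: "\<And>n. c n \<notin> bad_scalars c n"
    using ex_avoiding_bad_scalars[OF assms(1)] by blast
  \<comment> \<open>Indices are read as times through \<open>h\<close>; by injectivity, a finite set
    of zero times pulls back to a finite set of indices.\<close>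
  obtain h :: "'i \<Rightarrow> nat" where h: "inj h" using assms(2) by (auto simp: countable_def)
  define w where "w f i = c (h i) ^ prefix_code f (h i)" for f i
  have sum_apply: "(\<Sum>f\<in>F. fun_scale (a f) (w f)) i = (\<Sum>f\<in>F. a f * w f i)" for F a i
    by (induction F rule: infinite_finite_induct) (auto simp: fun_scale_def)
  have fin: "finite {i. (\<Sum>f\<in>F. fun_scale (a f) (w f)) i = 0}"
    if "finite F" "f \<in> F" "a f \<noteq> 0" for F a f
    using finite_vimageI[OF
        finite_zeros_combination[where c = c and F = F and f = f and a = a, OF c that] h]
    by (simp add: sum_apply w_def vimage_def)
  \<comment> \<open>The zero function vanishes on the whole infinite index set, against
    \<open>fin\<close>.\<close>
  have zero: "a f = 0" if "finite F" "(\<Sum>f\<in>F. fun_scale (a f) (w f)) = 0" "f \<in> F" for F a f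
    using fin[of F f a] that assms(3) by auto
  have inj: "inj w"
  proof (rule injI, rule ccontr)
    fix f f' assume eq: "w f = w f'" and "f \<noteq> f'"
    then have "(\<Sum>g\<in>{f, f'}. fun_scale (if g = f then 1 else - 1) (w g)) = 0"
      by (auto simp: fun_scale_def fun_eq_iff)
    then show False using zero[of "{f, f'}" "\<lambda>g. if g = f then 1 else - 1" f] by simp
  qed
  have indep: "vs.independent (range w)"
    unfolding vs.dependent_explicit
  proof clarify
    fix T u v assume T: "finite T" "T \<subseteq> range w" "(\<Sum>v\<in>T. fun_scale (u v) v) = 0"
      and v: "v \<in> T" "u v \<noteq> 0"
    obtain F where F: "finite F" "T = w ` F"
      using finite_subset_image[OF T(1,2)] by blast
    then obtain f where "f \<in> F" "v = w f" using v by blast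
    then show False
      using zero[of F "u \<circ> w" f] T v F by (simp add: sum.reindex[OF inj_on_subset[OF inj]])
  qed
  define W where "W = vs.span (range w)"
  have finW: "finite {i. x i = 0}" if x: "x \<in> W" "x \<noteq> 0" for x
  proof -
    obtain T u where T: "finite T" "T \<subseteq> range w" "x = (\<Sum>v\<in>T. fun_scale (u v) v)"
      using x(1) unfolding W_def vs.span_explicit by blast
    obtain F where F: "finite F" "T = w ` F"
      using finite_subset_image[OF T(1,2)] by blast
    have x_eq: "x = (\<Sum>f\<in>F. fun_scale (u (w f)) (w f))"
      using T F by (simp add: sum.reindex[OF inj_on_subset[OF inj]])
    then have "\<exists>f\<in>F. u (w f) \<noteq> 0"
      using x(2) by (metis (no_types, lifting) sum.neutral vs.scale_zero_left)
    then show ?thesis using fin[OF F(1)] x_eq by auto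
  qed
  have subW: "vs.subspace W" by (simp add: W_def)
  have card: "|range w| =o continuum"
    unfolding continuum_eq
    by (rule ordIso_symmetric[OF card_of_ordIsoI]) (rule inj_on_imp_bij_betw[OF inj])
  have dimW: "card_dim fun_scale W =o continuum"
    unfolding W_def
    using card_dim_span[OF vector_space_fun_scale indep] card by (rule ordIso_transitive)
  have "\<exists>u. g u = 0 \<and> cofinite_support u"
    if V: "vector_space scaleV" and dim: "card_dim scaleV UNIV <o continuum"
      and g: "Vector_Spaces.linear fun_scale scaleV g"
    for scaleV :: "'k \<Rightarrow> 'v \<Rightarrow> 'v" and g :: "('i \<Rightarrow> 'k) \<Rightarrow> 'v"
  proof (rule ccontr)
    assume neg: "\<nexists>u. g u = 0 \<and> cofinite_support u"
    interpret g: Vector_Spaces.linear fun_scale scaleV g by fact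
    have injg: "inj_on g (vs.span (range w))"
      using inj_on_subspace_if_cofinite_support_notin_kernel[OF g subW finW] neg
      unfolding W_def by blast
    \<comment> \<open>The injective map \<open>g\<close> on \<open>W\<close> carries the basis
      \<open>range w\<close> to an independent set of continuum size, too large for the target
      space.\<close>
    have "continuum =o |range w|" using card by (rule ordIso_symmetric)
    also have "|range w| =o |g ` range w|"
      using inj_on_subset[OF injg vs.span_superset]
      by (intro card_of_ordIsoI) (rule inj_on_imp_bij_betw)
    also have "|g ` range w| \<le>o card_dim scaleV UNIV"
      using g.independent_injective_image[OF indep injg]
      by (rule card_independent_le_card_dim[OF V])
    finally show False using dim not_ordLess_ordLeq by blast
  qed
  then show ?thesis using subW dimW finW by blast
qed

end
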